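(* Let $K\ge1$, $\mathcal{Y}=\{0,\dots,K-1\}$, and for an input $x$ let $\hat f(\cdot|x)$ be a probability vector on $\mathcal{Y}$ (the model scores). Put $\hat y=\mathrm{argmax}_i\,\hat f(i|x)$. For a threshold $\lambda\ge0$ let $C_\lambda=[l(\lambda),u(\lambda)]$ be the output of the Greedy Divergence Algorithm described in the context. Then: (C1) $C_\lambda$ is a contiguous range of classes in $\mathcal{Y}$; (C2) $\hat y\in C_\lambda$; (C3) the sets are nested: $C_{\lambda_1}\subseteq C_{\lambda_2}$ whenever $\lambda_1\ge\lambda_2$; and $C_\lambda$ is optimal in the sense that $$(l(\lambda),u(\lambda))\in\underset{0\le l\le\hat y\le u\le K-1}{\mathrm{argmin}}\Big\{u-l:\ \sum_{i<l}(l-i)\hat f(i|x)+\sum_{i>u}(i-u)\hat f(i|x)\le\lambda\Big\}.$$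
   Context: $[l,u]$ denotes $\{l,l+1,\dots,u\}$, and sums over $i$ range over $i\in\mathcal{Y}$ subject to the indicated inequality. Ties in the argmax defining $\hat y$ are broken by a fixed choice, independent of $\lambda$. Define $$R(l,u)=\sum_{i<l}(l-i)\hat f(i|x)+\sum_{i>u}(i-u)\hat f(i|x),\qquad head(j)=\sum_{i\le j}\hat f(i|x),\qquad tail(j)=\sum_{i\ge j}\hat f(i|x),$$ so that $head(-1)=tail(K)=0$. Greedy Divergence Algorithm (input $\lambda$, $\hat f(\cdot|x)$): set $l=u=\hat y$ and $sum=R(l,u)$. While $sum>\lambda$: if $head(l-1)\ge tail(u+1)$, replace $sum$ by $sum-head(l-1)$ and $l$ by $l-1$; otherwise replace $sum$ by $sum-tail(u+1)$ and $u$ by $u+1$. Return $(l,u)$. *)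

theory Defs
  imports Complex_Main "HOL-Library.While_Combinator"
begin

text \<open>
  Classes are integers, not naturals, because the algorithm refers to the index \<open>-1\<close>.
  A score vector is a function on all integers of which only the values on \<open>classes K\<close>
  are ever used.
\<close>

definition classes :: "nat \<Rightarrow> int set" where
  "classes K = {0..int K - 1}"

definition prob_vector :: "nat \<Rightarrow> (int \<Rightarrow> real) \<Rightarrow> bool" where
  "prob_vector K p \<longleftrightarrow> (\<forall>i\<in>classes K. 0 \<le> p i) \<and> (\<Sum>i\<in>classes K. p i) = 1"

definition R :: "nat \<Rightarrow> (int \<Rightarrow> real) \<Rightarrow> int \<Rightarrow> int \<Rightarrow> real" where
  "R K p l u =
     (\<Sum>i\<in>{i\<in>classes K. i < l}. real_of_int (l - i) * p i) +
     (\<Sum>i\<in>{i\<in>classes K. i > u}. real_of_int (i - u) * p i)"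

definition head :: "nat \<Rightarrow> (int \<Rightarrow> real) \<Rightarrow> int \<Rightarrow> real" where
  "head K p j = (\<Sum>i\<in>{i\<in>classes K. i \<le> j}. p i)"

definition tail :: "nat \<Rightarrow> (int \<Rightarrow> real) \<Rightarrow> int \<Rightarrow> real" where
  "tail K p j = (\<Sum>i\<in>{i\<in>classes K. i \<ge> j}. p i)"

text \<open>The loop state is \<open>(l, u, sum)\<close>.\<close>

definition greedy_step ::
    "nat \<Rightarrow> (int \<Rightarrow> real) \<Rightarrow> int \<times> int \<times> real \<Rightarrow> int \<times> int \<times> real" where
  "greedy_step K p = (\<lambda>(l, u, s).
     if head K p (l - 1) \<ge> tail K p (u + 1)
     then (l - 1, u, s - head K p (l - 1))
     else (l, u + 1, s - tail K p (u + 1)))"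

text \<open>The result is \<open>None\<close> exactly if the loop does not terminate.\<close>

definition greedy_divergence ::
    "nat \<Rightarrow> (int \<Rightarrow> real) \<Rightarrow> int \<Rightarrow> real \<Rightarrow> (int \<times> int) option" where
  "greedy_divergence K p y lam =
     map_option (\<lambda>(l, u, s). (l, u))
       (while_option (\<lambda>(l, u, s). s > lam) (greedy_step K p) (y, y, R K p y y))"

end

theory Submission
  imports Defs
begin

text \<open>
  Lowering \<open>l\<close> by one decreases \<open>R\<close> by \<open>head (l - 1)\<close>, and raising \<open>u\<close> by one decreases it by
  \<open>tail (u + 1)\<close>. As the interval grows, the gains on either side are nonincreasing, so the greedy
  choice merges two sorted sequences: every gain taken is at least as large as every gain still
  available on the other side. Hence \<open>R\<close> is minimal among intervals of the same length around
  \<open>y\<close>, and no shorter interval can meet the threshold. Since the run does not depend on \<open>\<lambda>\<close>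
  except for its stopping time, smaller thresholds only extend it.
\<close>

section \<open>One-step changes of \<open>R\<close> and monotonicity of the gains\<close>

lemma finite_classes [simp]: "finite (classes K)"
  by (simp add: classes_def)

lemma R_lower: "R K p (l - 1) u = R K p l u - head K p (l - 1)"
proof -
  \<comment> \<open>The added index \<open>l - 1\<close> has weight zero; on the enlarged range
    every weight is one less than in \<open>R K p l u\<close>.\<close>
  have "(\<Sum>i\<in>{i\<in>classes K. i < l - 1}. real_of_int (l - 1 - i) * p i)
      = (\<Sum>i\<in>{i\<in>classes K. i \<le> l - 1}. real_of_int (l - 1 - i) * p i)"
    by (rule sum.mono_neutral_left) auto
  also have "\<dots> = (\<Sum>i\<in>{i\<in>classes K. i < l}. real_of_int (l - i) * p i - p i)"
    by (rule sum.cong) (auto simp: algebra_simps)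
  also have "\<dots> = (\<Sum>i\<in>{i\<in>classes K. i < l}. real_of_int (l - i) * p i) - head K p (l - 1)"
    by (simp add: head_def sum_subtractf)
  finally show ?thesis
    by (simp add: R_def)
qed

lemma R_raise: "R K p l (u + 1) = R K p l u - tail K p (u + 1)"
proof -
  have eq: "{i\<in>classes K. u + 1 \<le> i} = {i\<in>classes K. u < i}"
    by auto
  have "(\<Sum>i\<in>{i\<in>classes K. i > u + 1}. real_of_int (i - (u + 1)) * p i)
      = (\<Sum>i\<in>{i\<in>classes K. i > u}. real_of_int (i - (u + 1)) * p i)"
    by (rule sum.mono_neutral_left) auto
  also have "\<dots> = (\<Sum>i\<in>{i\<in>classes K. i > u}. real_of_int (i - u) * p i - p i)"
    by (rule sum.cong) (auto simp: algebra_simps)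
  also have "\<dots> = (\<Sum>i\<in>{i\<in>classes K. i > u}. real_of_int (i - u) * p i) - tail K p (u + 1)"
    by (simp add: tail_def sum_subtractf eq)
  finally show ?thesis
    by (simp add: R_def)
qed

lemma head_nonneg: "prob_vector K p \<Longrightarrow> 0 \<le> head K p j"
  by (auto simp: head_def prob_vector_def intro: sum_nonneg)

lemma tail_nonneg: "prob_vector K p \<Longrightarrow> 0 \<le> tail K p j"
  by (auto simp: tail_def prob_vector_def intro: sum_nonneg)

lemma head_mono: "prob_vector K p \<Longrightarrow> i \<le> j \<Longrightarrow> head K p i \<le> head K p j"
  unfolding head_def prob_vector_def by (rule sum_mono2) auto

lemma tail_antimono: "prob_vector K p \<Longrightarrow> i \<le> j \<Longrightarrow> tail K p j \<le> tail K p i"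
  unfolding tail_def prob_vector_def by (rule sum_mono2) auto

lemma head_eq_0: "j < 0 \<Longrightarrow> head K p j = 0"
  unfolding head_def classes_def by (rule sum.neutral) auto

lemma tail_eq_0: "j \<ge> int K \<Longrightarrow> tail K p j = 0"
  unfolding tail_def classes_def by (rule sum.neutral) auto

text \<open>A zero sum of nonnegative scores has only zero terms, so no score outside the interval
  contributes. Hence a positive \<open>R\<close> guarantees a positive gain on at least one
  side.\<close>

lemma R_eq_0:
  assumes "prob_vector K p" "head K p (l - 1) = 0" "tail K p (u + 1) = 0"
  shows "R K p l u = 0"
proof -
  have "\<forall>i\<in>{i\<in>classes K. i \<le> l - 1}. p i = 0"
    using assms(1,2) unfolding head_def prob_vector_def
    by (intro iffD1[OF sum_nonneg_eq_0_iff]) auto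
  moreover have "\<forall>i\<in>{i\<in>classes K. i \<ge> u + 1}. p i = 0"
    using assms(1,3) unfolding tail_def prob_vector_def
    by (intro iffD1[OF sum_nonneg_eq_0_iff]) auto
  ultimately show ?thesis
    by (simp add: R_def)
qed

lemma R_antimono_upper:
  assumes "prob_vector K p" "b \<le> c"
  shows "R K p a c \<le> R K p a b"
  using assms(2)
proof (induction rule: int_ge_induct)
  case (step i)
  then show ?case
    using tail_nonneg[OF assms(1), of "i + 1"] by (simp add: R_raise)
qed simp

section \<open>The merge invariant and minimality of \<open>R\<close> for a given length\<close>

text \<open>The gains taken so far are \<open>head j\<close> for \<open>j\<close> in
  \<open>{l..<y}\<close> and \<open>tail j\<close> for \<open>j\<close> in \<open>{y<..u}\<close>.
  Each is compared with the next gain on the opposite side; monotonicity covers its own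
  side.\<close>

definition greedy_inv :: "nat \<Rightarrow> (int \<Rightarrow> real) \<Rightarrow> int \<Rightarrow> int \<times> int \<times> real \<Rightarrow> bool" where
  "greedy_inv K p y = (\<lambda>(l, u, s). l \<le> y \<and> y \<le> u \<and> s = R K p l u \<and>
     (\<forall>j\<in>{l..<y}. tail K p (u + 1) \<le> head K p j) \<and>
     (\<forall>j\<in>{y<..u}. head K p (l - 1) \<le> tail K p j))"

lemma greedy_inv_step:
  assumes p: "prob_vector K p" and inv: "greedy_inv K p y z"
  shows "greedy_inv K p y (greedy_step K p z)"
proof -
  obtain l u s where z: "z = (l, u, s)"
    by (cases z)
  note inv = inv[unfolded z greedy_inv_def prod.case]
  show ?thesis
  proof (cases "tail K p (u + 1) \<le> head K p (l - 1)")
    case True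
    \<comment> \<open>The only new left gain is \<open>j = l - 1\<close>, settled by the branch
      condition; below, the next left gain has only shrunk.\<close>
    have "tail K p (u + 1) \<le> head K p j" if "j \<in> {l - 1..<y}" for j
      using inv True that by (cases "j = l - 1") auto
    moreover have "head K p (l - 1 - 1) \<le> tail K p j" if "j \<in> {y<..u}" for j
      using inv that head_mono[OF p, of "l - 1 - 1" "l - 1"] order_trans by fastforce
    ultimately show ?thesis
      using inv True by (simp add: z greedy_step_def greedy_inv_def R_lower)
  next
    case False
    have "tail K p (u + 1 + 1) \<le> head K p j" if "j \<in> {l..<y}" for j
      using inv that tail_antimono[OF p, of "u + 1" "u + 1 + 1"] order_trans by fastforce
    moreover have "head K p (l - 1) \<le> tail K p j" if "j \<in> {y<..u + 1}" for j
      using inv False that by (cases "j = u + 1") auto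
    ultimately show ?thesis
      using inv False by (simp add: z greedy_step_def greedy_inv_def R_raise)
  qed
qed

text \<open>Each unit shift trades a right gain already taken for a left gain not yet taken, which
  is no larger. The premise keeps every surrendered index \<open>u - i\<close> with
  \<open>i < k\<close> above \<open>y\<close>.\<close>

lemma R_le_shift_left:
  assumes p: "prob_vector K p" and inv: "greedy_inv K p y (l, u, s)"
  shows "y \<le> u - int k \<Longrightarrow> R K p l u \<le> R K p (l - int k) (u - int k)"
proof (induction k)
  case (Suc k)
  let ?a = "l - int k" and ?b = "u - int k"
  have "head K p (?a - 1) \<le> head K p (l - 1)"
    using p by (rule head_mono) simp
  also have "\<dots> \<le> tail K p ?b"
    using inv Suc.prems by (auto simp: greedy_inv_def)
  finally have "R K p ?a ?b \<le> R K p (?a - 1) (?b - 1)"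
    using R_lower[of K p ?a "?b - 1"] R_raise[of K p ?a "?b - 1"] by simp
  then show ?case
    using Suc by (simp add: algebra_simps)
qed simp

lemma R_le_shift_right:
  assumes p: "prob_vector K p" and inv: "greedy_inv K p y (l, u, s)"
  shows "l + int k \<le> y \<Longrightarrow> R K p l u \<le> R K p (l + int k) (u + int k)"
proof (induction k)
  case (Suc k)
  let ?a = "l + int k" and ?b = "u + int k"
  have "tail K p (?b + 1) \<le> tail K p (u + 1)"
    using p by (rule tail_antimono) simp
  also have "\<dots> \<le> head K p ?a"
    using inv Suc.prems by (auto simp: greedy_inv_def)
  finally have "R K p ?a ?b \<le> R K p (?a + 1) (?b + 1)"
    using R_lower[of K p "?a + 1" "?b + 1"] R_raise[of K p ?a ?b] by simp
  then show ?case
    using Suc by (simp add: algebra_simps)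
qed simp

text \<open>Widening \<open>[a, b]\<close> on the right to the length of \<open>[l, u]\<close>
  cannot increase \<open>R\<close>, and the widened interval is a shift of \<open>[l, u]\<close>.
  Its right end may leave the classes, where \<open>R\<close> is still defined.\<close>

lemma greedy_inv_R_le:
  assumes p: "prob_vector K p" and inv: "greedy_inv K p y (l, u, s)"
    and "a \<le> y" "y \<le> b" "b - a \<le> u - l"
  shows "R K p l u \<le> R K p a b"
proof -
  define c where "c = a + (u - l)"
  have "R K p l u \<le> R K p a c"
  proof (cases "a \<le> l")
    case True
    then show ?thesis
      using R_le_shift_left[OF p inv, of "nat (l - a)"] assms(4,5) by (simp add: c_def algebra_simps)
  next
    case False
    then show ?thesis
      using R_le_shift_right[OF p inv, of "nat (a - l)"] assms(3) by (simp add: c_def algebra_simps)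
  qed
  also have "\<dots> \<le> R K p a b"
    using p by (rule R_antimono_upper) (use assms(5) in \<open>simp add: c_def\<close>)
  finally show ?thesis .
qed

section \<open>The run without its stopping test\<close>

definition greedy_state :: "nat \<Rightarrow> (int \<Rightarrow> real) \<Rightarrow> int \<Rightarrow> nat \<Rightarrow> int \<times> int \<times> real" where
  "greedy_state K p y n = (greedy_step K p ^^ n) (y, y, R K p y y)"

abbreviation "lo K p y n \<equiv> fst (greedy_state K p y n)"
abbreviation "hi K p y n \<equiv> fst (snd (greedy_state K p y n))"
abbreviation "rest K p y n \<equiv> snd (snd (greedy_state K p y n))"

lemma greedy_state_Suc:
  "greedy_state K p y (Suc n) = greedy_step K p (greedy_state K p y n)"
  by (simp add: greedy_state_def)

lemma greedy_inv_state: "prob_vector K p \<Longrightarrow> greedy_inv K p y (greedy_state K p y n)"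
proof (induction n)
  case 0
  then show ?case
    by (simp add: greedy_state_def greedy_inv_def)
next
  case (Suc n)
  then show ?case
    by (simp add: greedy_state_Suc greedy_inv_step)
qed

lemma
  assumes "prob_vector K p"
  shows lo_le: "lo K p y n \<le> y"
    and le_hi: "y \<le> hi K p y n"
    and rest_eq: "rest K p y n = R K p (lo K p y n) (hi K p y n)"
  using greedy_inv_state[OF assms, of y n] by (auto simp: greedy_inv_def split: prod.splits)

text \<open>Every step widens the interval by one, so interval length and running time are
  interchangeable.\<close>

lemma hi_minus_lo: "hi K p y n - lo K p y n = int n"
proof (induction n)
  case 0
  then show ?case
    by (simp add: greedy_state_def)
next
  case (Suc n)
  then show ?case
    by (auto simp: greedy_state_Suc greedy_step_def split: prod.splits)
qed

lemma greedy_state_mono: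
  assumes "m \<le> n"
  shows "lo K p y n \<le> lo K p y m \<and> hi K p y m \<le> hi K p y n"
  using assms
proof (induction rule: dec_induct)
  case (step k)
  then show ?case
    by (auto simp: greedy_state_Suc greedy_step_def split: prod.splits)
qed simp

text \<open>
  A step leaves the classes only if both available gains vanish; but then \<open>R\<close> is already zero
  and the loop has stopped.
\<close>

lemma greedy_state_in_classes:
  assumes p: "prob_vector K p" and y: "y \<in> classes K"
    and run: "\<And>m. m < n \<Longrightarrow> 0 < rest K p y m"
  shows "0 \<le> lo K p y n \<and> hi K p y n < int K"
  using run
proof (induction n)
  case 0
  then show ?case
    using y by (simp add: greedy_state_def classes_def)
next
  case (Suc n)
  obtain l u s where z: "greedy_state K p y n = (l, u, s)"
    by (cases "greedy_state K p y n")
  have bounds: "0 \<le> l" "u < int K"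
    using Suc z by auto
  have "0 < R K p l u"
    using Suc.prems[of n] rest_eq[OF p, of y n] z by simp
  then have "head K p (l - 1) \<noteq> 0 \<or> tail K p (u + 1) \<noteq> 0"
    using R_eq_0[OF p] by fastforce
  \<comment> \<open>The left branch is also taken on ties, so positivity of \<open>R\<close> must
    exclude a tie at zero; the right branch has a strictly positive gain by its condition.\<close>
  then have "0 \<le> l - 1" if "tail K p (u + 1) \<le> head K p (l - 1)"
    using that tail_nonneg[OF p, of "u + 1"] head_eq_0[of "l - 1" K p] by linarith
  moreover have "u + 1 < int K" if "\<not> tail K p (u + 1) \<le> head K p (l - 1)"
    using that head_nonneg[OF p, of "l - 1"] tail_eq_0[of K "u + 1" p] by linarith
  ultimately show ?case
    using bounds by (auto simp: greedy_state_Suc greedy_step_def z)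
qed

text \<open>Otherwise the run would stay inside the classes for \<open>K\<close> steps, yet its ends
  would then be \<open>K\<close> apart.\<close>

lemma greedy_stops:
  assumes "prob_vector K p" "y \<in> classes K" "0 \<le> lam"
  shows "\<exists>n. rest K p y n \<le> lam"
proof (rule ccontr)
  assume "\<nexists>n. rest K p y n \<le> lam"
  then have "0 < rest K p y m" for m
    using assms(3) by (meson le_less_trans not_le)
  then show False
    using greedy_state_in_classes[OF assms(1,2), of K] hi_minus_lo[of K p y K] by simp
qed

section \<open>Stopping times and the output\<close>

definition stop_time :: "nat \<Rightarrow> (int \<Rightarrow> real) \<Rightarrow> int \<Rightarrow> real \<Rightarrow> nat" where
  "stop_time K p y lam = (LEAST n. rest K p y n \<le> lam)"

lemma rest_stop_time:
  assumes "prob_vector K p" "y \<in> classes K" "0 \<le> lam"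
  shows "rest K p y (stop_time K p y lam) \<le> lam"
  unfolding stop_time_def using greedy_stops[OF assms] by (rule LeastI_ex)

lemma rest_before_stop_time: "m < stop_time K p y lam \<Longrightarrow> lam < rest K p y m"
  unfolding stop_time_def using not_less_Least not_le by blast

lemma stop_time_antimono:
  assumes "prob_vector K p" "y \<in> classes K" "0 \<le> lam2" "lam2 \<le> lam1"
  shows "stop_time K p y lam1 \<le> stop_time K p y lam2"
  using rest_stop_time[OF assms(1-3)] assms(4)
  unfolding stop_time_def[of _ _ _ lam1] by (intro Least_le) simp

text \<open>\<open>while_option\<close> is itself defined by the least iterate failing the test,
  which is \<open>stop_time\<close> once some iterate fails.\<close>

lemma greedy_divergence_eq:
  assumes "prob_vector K p" "y \<in> classes K" "0 \<le> lam"
  shows "greedy_divergence K p y lam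
    = Some (lo K p y (stop_time K p y lam), hi K p y (stop_time K p y lam))"
proof -
  have "\<exists>n. \<not> (case greedy_state K p y n of (l, u, s) \<Rightarrow> s > lam)"
    using greedy_stops[OF assms] by (auto simp: split_beta not_less)
  then show ?thesis
    unfolding greedy_divergence_def while_option_def greedy_state_def stop_time_def
    by (auto simp: split_beta not_less)
qed

theorem theorem3:
  fixes K :: nat and fhat :: "'x \<Rightarrow> int \<Rightarrow> real" and x :: 'x and yhat :: int
  assumes "K \<ge> 1"
    and "prob_vector K (fhat x)"
    and "is_arg_max (fhat x) (\<lambda>i. i \<in> classes K) yhat"
  shows "\<exists>l u :: real \<Rightarrow> int.
    (\<forall>lam\<ge>0. greedy_divergence K (fhat x) yhat lam = Some (l lam, u lam)) \<and>
    (\<forall>lam\<ge>0. l lam \<le> u lam \<and> {l lam..u lam} \<subseteq> classes K) \<and>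
    (\<forall>lam\<ge>0. yhat \<in> {l lam..u lam}) \<and>
    (\<forall>lam1 lam2. lam1 \<ge> lam2 \<and> lam2 \<ge> 0 \<longrightarrow> {l lam1..u lam1} \<subseteq> {l lam2..u lam2}) \<and>
    (\<forall>lam\<ge>0. is_arg_min (\<lambda>(a, b). b - a)
       (\<lambda>(a, b). 0 \<le> a \<and> a \<le> yhat \<and> yhat \<le> b \<and> b \<le> int K - 1 \<and> R K (fhat x) a b \<le> lam)
       (l lam, u lam))"
proof -
  let ?p = "fhat x"
  let ?n = "stop_time K ?p yhat"
  have p: "prob_vector K ?p"
    by (fact assms(2))
  have y: "yhat \<in> classes K"
    using assms(3) by (simp add: is_arg_max_def)
  have bounds: "0 \<le> lo K ?p yhat (?n lam) \<and> hi K ?p yhat (?n lam) < int K" if "0 \<le> lam" for lam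
  proof (rule greedy_state_in_classes[OF p y])
    show "0 < rest K ?p yhat m" if "m < ?n lam" for m
      using rest_before_stop_time[OF that] \<open>0 \<le> lam\<close> by simp
  qed
  have opt: "\<not> b - a < hi K ?p yhat (?n lam) - lo K ?p yhat (?n lam)"
    if "a \<le> yhat" "yhat \<le> b" "R K ?p a b \<le> lam" for a b lam
  proof
    assume "b - a < hi K ?p yhat (?n lam) - lo K ?p yhat (?n lam)"
    then have short: "b - a < int (?n lam)"
      by (simp add: hi_minus_lo)
    \<comment> \<open>The state just before stopping: its \<open>R\<close> still exceeds
      \<open>lam\<close> and is minimal for intervals of length at most \<open>m\<close>. Since
      \<open>0 \<le> b - a < int (?n lam)\<close>, the natural subtraction does not
      truncate.\<close>
    define m where "m = ?n lam - 1"
    have m: "m < ?n lam" "b - a \<le> int m"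
      using short that(1,2) by (auto simp: m_def)
    obtain l u s where z: "greedy_state K ?p yhat m = (l, u, s)"
      by (cases "greedy_state K ?p yhat m")
    have "lam < R K ?p l u"
      using rest_before_stop_time[OF m(1)] rest_eq[OF p, of yhat m] z by simp
    also have "\<dots> \<le> R K ?p a b"
      using greedy_inv_R_le[OF p, of yhat l u s a b] greedy_inv_state[OF p, of yhat m]
        hi_minus_lo[of K ?p yhat m] that m(2) z by simp
    finally show False
      using that(3) by simp
  qed
  show ?thesis
  proof (rule exI[of _ "\<lambda>lam. lo K ?p yhat (?n lam)"],
      rule exI[of _ "\<lambda>lam. hi K ?p yhat (?n lam)"], intro conjI allI impI)
    fix lam :: real assume lam: "0 \<le> lam"
    note le = lo_le[OF p, of yhat "?n lam"] le_hi[OF p, of yhat "?n lam"]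
    show "greedy_divergence K ?p yhat lam
        = Some (lo K ?p yhat (?n lam), hi K ?p yhat (?n lam))"
      using p y lam by (rule greedy_divergence_eq)
    show "lo K ?p yhat (?n lam) \<le> hi K ?p yhat (?n lam)"
      using le by simp
    show "{lo K ?p yhat (?n lam)..hi K ?p yhat (?n lam)} \<subseteq> classes K"
      using bounds[OF lam] by (auto simp: classes_def)
    show "yhat \<in> {lo K ?p yhat (?n lam)..hi K ?p yhat (?n lam)}"
      using le by simp
    show "is_arg_min (\<lambda>(a, b). b - a)
       (\<lambda>(a, b). 0 \<le> a \<and> a \<le> yhat \<and> yhat \<le> b \<and> b \<le> int K - 1 \<and> R K ?p a b \<le> lam)
       (lo K ?p yhat (?n lam), hi K ?p yhat (?n lam))"
      using le bounds[OF lam] rest_stop_time[OF p y lam] rest_eq[OF p, of yhat "?n lam"] opt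
      by (auto simp: is_arg_min_def)
  next
    fix lam1 lam2 :: real assume "lam1 \<ge> lam2 \<and> lam2 \<ge> 0"
    then have "?n lam1 \<le> ?n lam2"
      using stop_time_antimono[OF p y] by blast
    then show "{lo K ?p yhat (?n lam1)..hi K ?p yhat (?n lam1)}
        \<subseteq> {lo K ?p yhat (?n lam2)..hi K ?p yhat (?n lam2)}"
      using greedy_state_mono[of "?n lam1" "?n lam2" K ?p yhat] by simp
  qed
qed

end
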